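(* Let $X$ be a normed space over $\mathbb{F}\in\{\mathbb{R},\mathbb{C}\}$ with dimension not less than 2. Then numerical radius parallelism in $\mathbb{B}(X)$ fails to be transitive; that is, there exist $T,S,R\in\mathbb{B}(X)\setminus\{0\}$ such that $T\parallel_v S$ and $S\parallel_v R$ hold but $T\parallel_v R$ does not hold.
   Context: $\mathbb{B}(X)$ is the space of bounded linear operators $X\to X$; $S_X$ is the unit sphere of $X$ and $S_{X^*}$ that of its dual $X^*$; $\mathbb{T}=\{\lambda\in\mathbb{F}:|\lambda|=1\}$. For $x\in X$, $J(x)=\{x^*\in S_{X^*}: x^*(x)=\|x\|\}$. The numerical radius of $T\in\mathbb{B}(X)$ is $v(T)=\sup\{|x^*(Tx)|: x\in S_X,\ x^*\in J(x)\}$. $T$ is numerical radius parallel to $S$, written $T\parallel_v S$, if $v(T+\lambda S)=v(T)+v(S)$ for some $\lambda\in\mathbb{T}$. Transitivity means the implication: $T,S,R\in\mathbb{B}(X)\setminus\{0\}$, $T\parallel_v S$, $S\parallel_v R$ $\Rightarrow$ $T\parallel_v R$. *)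

theory Defs
  imports "HOL-Analysis.Analysis"
begin

text \<open>
  A normed space over the scalar field \<open>'f\<close>, which is used below at \<^typ>\<open>real\<close> and
  \<^typ>\<open>complex\<close>. The library has no class of complex normed spaces; since every complex normed
  space is in particular a real one, the addition and the norm are those of the class
  \<^class>\<open>real_normed_vector\<close> and only the scalar multiplication \<open>scl\<close> is a parameter.
  Completeness is not assumed.
\<close>

locale normed_space_over = vector_space scl
  for scl :: "'f::real_normed_field \<Rightarrow> 'a::real_normed_vector \<Rightarrow> 'a" +
  assumes scale_of_real: "scl (of_real r) x = r *\<^sub>R x"
    and norm_scale: "norm (scl c x) = norm c * norm x"

lemma normed_space_over_scaleR:
  "normed_space_over (scaleR :: real \<Rightarrow> 'a::real_normed_vector \<Rightarrow> 'a)"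
  by unfold_locales (simp_all add: algebra_simps)

text \<open>
  The library's \<open>dim\<close> is \<open>0\<close> for infinite-dimensional spaces, which are to be included here,
  so the condition on the dimension is stated through the size of a basis.
\<close>

definition dimension_ge_2 :: "('f::field \<Rightarrow> 'a::ab_group_add \<Rightarrow> 'a) \<Rightarrow> bool" where
  "dimension_ge_2 scl \<longleftrightarrow>
    (\<exists>B. \<not> module.dependent scl B \<and> module.span scl B = UNIV \<and> (infinite B \<or> 2 \<le> card B))"

definition bounded_linear_maps ::
  "('f::field \<Rightarrow> 'a::real_normed_vector \<Rightarrow> 'a) \<Rightarrow> ('f \<Rightarrow> 'b::real_normed_vector \<Rightarrow> 'b) \<Rightarrow> ('a \<Rightarrow> 'b) set"
  where
  "bounded_linear_maps scl1 scl2 =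
    {T. Vector_Spaces.linear scl1 scl2 T \<and> (\<exists>K. \<forall>x. norm (T x) \<le> K * norm x)}"

abbreviation bounded_operators ::
  "('f::field \<Rightarrow> 'a::real_normed_vector \<Rightarrow> 'a) \<Rightarrow> ('a \<Rightarrow> 'a) set" where
  "bounded_operators scl \<equiv> bounded_linear_maps scl scl"

definition dual_sphere ::
  "('f::real_normed_field \<Rightarrow> 'a::real_normed_vector \<Rightarrow> 'a) \<Rightarrow> ('a \<Rightarrow> 'f) set" where
  "dual_sphere scl = {f \<in> bounded_linear_maps scl (*). onorm f = 1}"

definition norming_functionals ::
  "('f::real_normed_field \<Rightarrow> 'a::real_normed_vector \<Rightarrow> 'a) \<Rightarrow> 'a \<Rightarrow> ('a \<Rightarrow> 'f) set" where
  "norming_functionals scl x = {f \<in> dual_sphere scl. f x = of_real (norm x)}"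

definition numerical_radius ::
  "('f::real_normed_field \<Rightarrow> 'a::real_normed_vector \<Rightarrow> 'a) \<Rightarrow> ('a \<Rightarrow> 'a) \<Rightarrow> real" where
  "numerical_radius scl T =
    Sup {norm (f (T x)) | x f. norm x = 1 \<and> f \<in> norming_functionals scl x}"

definition numerical_radius_parallel ::
  "('f::real_normed_field \<Rightarrow> 'a::real_normed_vector \<Rightarrow> 'a) \<Rightarrow> ('a \<Rightarrow> 'a) \<Rightarrow> ('a \<Rightarrow> 'a) \<Rightarrow> bool" where
  "numerical_radius_parallel scl T S \<longleftrightarrow>
    (\<exists>c. norm c = 1 \<and>
      numerical_radius scl (\<lambda>x. T x + scl c (S x)) =
        numerical_radius scl T + numerical_radius scl S)"

end

theory Submission imports Defs begin

text \<open>
  Take for \<open>S\<close> the identity and for \<open>T\<close> and \<open>R\<close> the norm-one projections \<open>f \<otimes> x\<close> and \<open>g \<otimes> z\<close>,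
  where \<open>f\<close> and \<open>g\<close> norm the unit vectors \<open>x\<close> and \<open>z\<close>. Both projections are parallel to the
  identity. If \<open>norm (x + d z)\<close> is at most \<open>K < 2\<close> for all unimodular \<open>d\<close>, then so is the numerical
  radius of \<open>T + c R\<close> for unimodular \<open>c\<close>, and \<open>T\<close> is not parallel to \<open>R\<close>. Such \<open>x\<close> and \<open>z\<close> exist: on a
  two-dimensional subspace identified with the Euclidean plane over the scalars, let \<open>x\<close> maximise
  the norm on the Euclidean unit sphere and let \<open>z\<close> be orthogonal to \<open>x\<close>; then the norm of \<open>x + s z\<close>
  grows at most quadratically in \<open>s\<close>, so \<open>x\<close> is a smooth point.
\<close>

section \<open>Hahn-Banach by minimal sublinear functionals\<close>

text \<open>Homogeneity is asked only as an inequality for positive scalars, which is easy to check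
  for infima; using it for a scalar and its inverse restores equality.\<close>

definition sublinear :: "('a::real_vector \<Rightarrow> real) \<Rightarrow> bool" where
  "sublinear q \<longleftrightarrow>
    (\<forall>x y. q (x + y) \<le> q x + q y) \<and> (\<forall>c x. 0 < c \<longrightarrow> q (c *\<^sub>R x) \<le> c * q x)"

lemma sublinearD:
  assumes "sublinear q"
  shows "q (x + y) \<le> q x + q y" and "0 < c \<Longrightarrow> q (c *\<^sub>R x) \<le> c * q x"
  using assms by (auto simp: sublinear_def)

lemma sublinear_scaleR:
  assumes q: "sublinear q" and c: "0 \<le> c"
  shows "q (c *\<^sub>R x) = c * q x"
proof -
  have pos: "q (a *\<^sub>R y) = a * q y" if a: "0 < a" for a y
  proof (rule antisym)
    show "q (a *\<^sub>R y) \<le> a * q y" using sublinearD(2)[OF q a] .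
    have "q (inverse a *\<^sub>R (a *\<^sub>R y)) \<le> inverse a * q (a *\<^sub>R y)"
      using a by (intro sublinearD(2)[OF q]) simp
    with a show "a * q y \<le> q (a *\<^sub>R y)" by (simp add: field_simps)
  qed
  have "q 0 = 0" using pos[of 2 0] by simp
  with pos c show ?thesis by (cases "c = 0") auto
qed

lemma sublinear_minus_le:
  assumes q: "sublinear q"
  shows "- q (- x) \<le> q x"
  using sublinearD(1)[OF q, of x "- x"] sublinear_scaleR[OF q, of 0 x] by simp

text \<open>
  The tilted functional is the largest sublinear functional below \<open>q\<close> with value at most \<open>- q v\<close>
  at \<open>- v\<close>. A minimal sublinear functional therefore equals all its tilts, hence is odd and linear.
  Tilting the norm at \<open>x\<close> before minimising yields a functional norming \<open>x\<close>.
\<close>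

definition tilt :: "('a::real_vector \<Rightarrow> real) \<Rightarrow> 'a \<Rightarrow> 'a \<Rightarrow> real" where
  "tilt q v y = (INF t\<in>{0..}. q (y + t *\<^sub>R v) - t * q v)"

text \<open>Subadditivity applied to \<open>t v = (y + t v) + (- y)\<close>. The bound does not
  depend on \<open>t\<close>, so the infimum in \<open>tilt\<close> is over a set bounded
  below.\<close>

lemma tilt_lower:
  assumes q: "sublinear q" and t: "0 \<le> t"
  shows "- q (- y) \<le> q (y + t *\<^sub>R v) - t * q v"
  using sublinearD(1)[OF q, of "y + t *\<^sub>R v" "- y"] sublinear_scaleR[OF q t, of v] by simp

lemma tilt_le:
  assumes q: "sublinear q" and t: "0 \<le> t"
  shows "tilt q v y \<le> q (y + t *\<^sub>R v) - t * q v"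
  unfolding tilt_def
  by (rule cINF_lower) (use tilt_lower[OF q] t in \<open>auto intro!: bdd_belowI2\<close>)

lemma le_tilt:
  assumes "\<And>t. 0 \<le> t \<Longrightarrow> b \<le> q (y + t *\<^sub>R v) - t * q v"
  shows "b \<le> tilt q v y"
  unfolding tilt_def by (rule cINF_greatest) (use assms in auto)

lemma sublinear_tilt:
  assumes q: "sublinear q"
  shows "sublinear (tilt q v)"
  unfolding sublinear_def
proof (intro conjI allI impI)
  fix x y
  \<comment> \<open>The two infima are removed one after the other: the parameters \<open>t\<close>
    for \<open>x\<close> and \<open>s\<close> for \<open>y\<close> combine into \<open>t + s\<close>
    for \<open>x + y\<close>.\<close>
  have "tilt q v (x + y) - (q (y + s *\<^sub>R v) - s * q v) \<le> tilt q v x" if s: "0 \<le> s" for s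
  proof (rule le_tilt)
    fix t :: real assume t: "0 \<le> t"
    have "tilt q v (x + y) \<le> q ((x + y) + (t + s) *\<^sub>R v) - (t + s) * q v"
      using s t by (intro tilt_le[OF q]) simp
    also have "(x + y) + (t + s) *\<^sub>R v = (x + t *\<^sub>R v) + (y + s *\<^sub>R v)"
      by (simp add: algebra_simps)
    finally show "tilt q v (x + y) - (q (y + s *\<^sub>R v) - s * q v) \<le> q (x + t *\<^sub>R v) - t * q v"
      using sublinearD(1)[OF q, of "x + t *\<^sub>R v" "y + s *\<^sub>R v"] by (simp add: algebra_simps)
  qed
  then have "tilt q v (x + y) - tilt q v x \<le> tilt q v y"
    by (intro le_tilt) (simp add: algebra_simps)
  then show "tilt q v (x + y) \<le> tilt q v x + tilt q v y" by simp
next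
  fix c :: real and x assume c: "0 < c"
  have "tilt q v (c *\<^sub>R x) / c \<le> tilt q v x"
  proof (rule le_tilt)
    fix t :: real assume t: "0 \<le> t"
    have "tilt q v (c *\<^sub>R x) \<le> q (c *\<^sub>R x + (c * t) *\<^sub>R v) - (c * t) * q v"
      using c t by (intro tilt_le[OF q]) simp
    also have "c *\<^sub>R x + (c * t) *\<^sub>R v = c *\<^sub>R (x + t *\<^sub>R v)" by (simp add: algebra_simps)
    also have "q \<dots> = c * q (x + t *\<^sub>R v)" using c by (intro sublinear_scaleR[OF q]) simp
    finally show "tilt q v (c *\<^sub>R x) / c \<le> q (x + t *\<^sub>R v) - t * q v"
      using c by (simp add: field_simps)
  qed
  then show "tilt q v (c *\<^sub>R x) \<le> c * tilt q v x" using c by (simp add: field_simps)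
qed

lemma tilt_le_self: "sublinear q \<Longrightarrow> tilt q v y \<le> q y"
  using tilt_le[of q 0 v y] by simp

lemma tilt_minus_le: "sublinear q \<Longrightarrow> tilt q v (- v) \<le> - q v"
  using tilt_le[of q 1 v "- v"] sublinear_scaleR[of q 0 v] by simp

text \<open>Zorn's lemma for the reversed pointwise order. The empty chain is bounded by
  \<open>p\<close>, any other by its pointwise infimum, which is finite because
  \<open>- p (- y) \<le> - q (- y) \<le> q y\<close> for each member \<open>q\<close>.\<close>

lemma exists_minimal_sublinear:
  assumes p: "sublinear p"
  shows "\<exists>q. sublinear q \<and> q \<le> p \<and> (\<forall>r. sublinear r \<longrightarrow> r \<le> q \<longrightarrow> r = q)"
proof -
  let ?A = "{q. sublinear q \<and> q \<le> p}" and ?P = "\<lambda>q r. r \<le> (q :: 'a \<Rightarrow> real)"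
  have "\<exists>m\<in>?A. \<forall>a\<in>?A. ?P m a \<longrightarrow> a = m"
  proof (rule predicate_Zorn)
    show "partial_order_on ?A (relation_of ?P ?A)"
      by (rule partial_order_on_relation_ofI) auto
    fix C assume C: "C \<in> Chains (relation_of ?P ?A)"
    then have CA: "C \<subseteq> ?A" by (auto simp: Chains_def relation_of_def)
    have total: "q \<le> r \<or> r \<le> q" if "q \<in> C" "r \<in> C" for q r
      using C that by (auto simp: Chains_def relation_of_def)
    show "\<exists>u\<in>?A. \<forall>a\<in>C. ?P a u"
    proof (cases "C = {}")
      case True
      then show ?thesis using p by blast
    next
      case False
      define u where "u y = (INF q\<in>C. q y)" for y
      have lower: "- p (- y) \<le> q y" if "q \<in> C" for q y
      proof -
        have "sublinear q" "q (- y) \<le> p (- y)" using CA that by (auto simp: le_fun_def)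
        then show ?thesis using sublinear_minus_le[of q y] by linarith
      qed
      have u_le: "u y \<le> q y" if "q \<in> C" for q y
        unfolding u_def by (rule cINF_lower) (use lower that in \<open>auto intro!: bdd_belowI2\<close>)
      have le_u: "b \<le> u y" if "\<And>q. q \<in> C \<Longrightarrow> b \<le> q y" for b y
        unfolding u_def by (rule cINF_greatest[OF False that])
      have "sublinear u"
        unfolding sublinear_def
      proof (intro conjI allI impI)
        fix x y
        have key: "u (x + y) \<le> q x + r y" if q: "q \<in> C" and r: "r \<in> C" for q r
        proof -
          \<comment> \<open>An infimum of sublinear functionals need not be subadditive; in a chain
            the smaller of \<open>q\<close> and \<open>r\<close> lies below both, and its
            subadditivity suffices.\<close>
          obtain s where s: "s \<in> C" "s \<le> q" "s \<le> r" using total[OF q r] q r by blast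
          have "u (x + y) \<le> s (x + y)" using u_le s by blast
          also have "\<dots> \<le> s x + s y" using sublinearD(1) CA s by blast
          also have "\<dots> \<le> q x + r y" using s by (simp add: le_fun_def add_mono)
          finally show ?thesis .
        qed
        have "u (x + y) - r y \<le> u x" if "r \<in> C" for r
          by (rule le_u) (use key that in \<open>simp add: algebra_simps\<close>)
        then have "u (x + y) - u x \<le> u y" by (intro le_u) (simp add: algebra_simps)
        then show "u (x + y) \<le> u x + u y" by simp
      next
        fix c :: real and x assume c: "0 < c"
        have "u (c *\<^sub>R x) / c \<le> u x"
        proof (rule le_u)
          fix q assume q: "q \<in> C"
          have "u (c *\<^sub>R x) \<le> q (c *\<^sub>R x)" by (rule u_le[OF q])
          also have "\<dots> \<le> c * q x" using sublinearD(2) CA q c by blast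
          finally have "u (c *\<^sub>R x) \<le> c * q x" .
          then show "u (c *\<^sub>R x) / c \<le> q x" using c by (simp add: field_simps)
        qed
        then show "u (c *\<^sub>R x) \<le> c * u x" using c by (simp add: field_simps)
      qed
      moreover have "u \<le> p"
      proof -
        obtain q where q: "q \<in> C" using False by blast
        then have "u \<le> q" using u_le by (simp add: le_fun_def)
        also have "q \<le> p" using CA q by blast
        finally show ?thesis .
      qed
      ultimately show ?thesis using u_le by (auto simp: le_fun_def)
    qed
  qed
  \<comment> \<open>Minimality within \<open>?A\<close> is minimality among all sublinear
    functionals, since whatever lies below \<open>q\<close> also lies below
    \<open>p\<close>.\<close>
  then show ?thesis by (blast intro: order_trans)
qed

lemma minimal_sublinear_linear:
  assumes q: "sublinear q" and min: "\<And>r. sublinear r \<Longrightarrow> r \<le> q \<Longrightarrow> r = q"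
  shows "linear q"
proof -
  have odd: "q (- v) = - q v" for v
  proof -
    have "tilt q v = q"
      by (intro min sublinear_tilt[OF q]) (simp add: le_fun_def tilt_le_self[OF q])
    then show ?thesis
      using tilt_minus_le[OF q, of v] sublinear_minus_le[OF q, of v] by simp
  qed
  show ?thesis
  proof (rule linearI)
    fix x y show "q (x + y) = q x + q y"
      using sublinearD(1)[OF q, of x y] sublinearD(1)[OF q, of "- x" "- y"] odd[of "x + y"]
      by (simp add: odd)
  next
    fix c x show "q (c *\<^sub>R x) = c *\<^sub>R q x"
      using sublinear_scaleR[OF q, of c x] sublinear_scaleR[OF q, of "- c" x] odd[of "c *\<^sub>R x"]
      by (cases "0 \<le> c") auto
  qed
qed

lemma exists_norming_linear:
  fixes x :: "'a::real_normed_vector"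
  shows "\<exists>f. linear f \<and> (\<forall>y. \<bar>f y\<bar> \<le> norm y) \<and> f x = norm x"
proof -
  have N: "sublinear (norm :: 'a \<Rightarrow> real)"
    by (auto simp: sublinear_def norm_triangle_ineq)
  obtain f where f: "sublinear f" "f \<le> tilt norm x" "\<And>r. sublinear r \<Longrightarrow> r \<le> f \<Longrightarrow> r = f"
    using exists_minimal_sublinear[OF sublinear_tilt[OF N, of x]] by blast
  have lin: "linear f" using f by (intro minimal_sublinear_linear)
  have le: "f y \<le> norm y" for y
    using f(2) tilt_le_self[OF N, of x y] by (meson le_fun_def order_trans)
  have "f (- x) \<le> - norm x"
    using f(2) tilt_minus_le[OF N, of x] by (meson le_fun_def order_trans)
  then have "f x = norm x" using le[of x] by (simp add: linear_neg[OF lin])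
  moreover have "\<bar>f y\<bar> \<le> norm y" for y
    using le[of y] le[of "- y"] by (simp add: linear_neg[OF lin])
  ultimately show ?thesis using lin by blast
qed

section \<open>Orthogonality in the scalar plane\<close>

text \<open>
  The conjugate is written as \<open>(norm c)\<^sup>2 / c\<close>, which covers the real and the complex scalars at once
  and is correct at \<open>c = 0\<close> because \<open>x / 0 = 0\<close>.
\<close>

lemma rotation_norm:
  fixes a b s :: "'f::{real_normed_field,real_inner}"
  defines "cnj' \<equiv> \<lambda>c. of_real ((norm c)\<^sup>2) / c"
  shows "(norm (a - s * cnj' b))\<^sup>2 + (norm (b + s * cnj' a))\<^sup>2 =
    (1 + (norm s)\<^sup>2) * ((norm a)\<^sup>2 + (norm b)\<^sup>2)"
proof -
  have sq: "(norm (x + y))\<^sup>2 = (norm x)\<^sup>2 + (norm y)\<^sup>2 + 2 * inner x y" for x y :: 'f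
    by (simp add: power2_norm_eq_inner inner_simps inner_commute)
  \<comment> \<open>Multiplying by \<open>d\<close> clears the conjugate, because
    \<open>cnj' d * d\<close> is the squared norm of \<open>d\<close>; this factor cancels at the
    end.\<close>
  have expand: "(norm (c + t * cnj' d))\<^sup>2 =
      (norm c)\<^sup>2 + (norm t)\<^sup>2 * (norm d)\<^sup>2 + 2 * inner (c * d) t" for c d t :: 'f
  proof (cases "d = 0")
    case True
    then show ?thesis by (simp add: cnj'_def)
  next
    case False
    have "(c + t * cnj' d) * d = c * d + (norm d)\<^sup>2 *\<^sub>R t"
      using False by (simp add: cnj'_def field_simps scaleR_conv_of_real)
    then have "(norm (c + t * cnj' d))\<^sup>2 * (norm d)\<^sup>2 = (norm (c * d + (norm d)\<^sup>2 *\<^sub>R t))\<^sup>2"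
      by (metis norm_mult power_mult_distrib)
    also have "\<dots> = ((norm c)\<^sup>2 + (norm t)\<^sup>2 * (norm d)\<^sup>2 + 2 * inner (c * d) t) * (norm d)\<^sup>2"
      unfolding sq by (simp add: norm_mult power_mult_distrib power2_eq_square algebra_simps)
    finally show ?thesis using False by simp
  qed
  \<comment> \<open>The cross terms \<open>inner (a * b) (- s)\<close> and
    \<open>inner (b * a) s\<close> cancel by commutativity.\<close>
  show ?thesis
    using expand[of a "- s" b] expand[of b s a] by (simp add: algebra_simps mult.commute[of b a])
qed

section \<open>Norming functionals and numerical radii of rank-one operators\<close>

context normed_space_over
begin

lemma norming_functionalsD:
  assumes "f \<in> norming_functionals scl x"
  shows "Vector_Spaces.linear scl (*) f" and "norm (f y) \<le> norm y"
    and "f x = of_real (norm x)"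
proof -
  obtain K where K: "\<And>y. norm (f y) \<le> K * norm y" and on: "onorm f = 1"
    and lin: "Vector_Spaces.linear scl (*) f"
    using assms by (auto simp: norming_functionals_def dual_sphere_def bounded_linear_maps_def)
  interpret f: Vector_Spaces.linear scl "(*)" f by (rule lin)
  \<comment> \<open>The bound by \<open>onorm\<close> is available for real-linear maps; real
    homogeneity comes from \<open>scale_of_real\<close>.\<close>
  have "bounded_linear f"
  proof (rule bounded_linear_intro)
    show "f (r *\<^sub>R y) = r *\<^sub>R f y" for r y
      by (simp flip: scale_of_real add: f.scale scaleR_conv_of_real)
  qed (use f.add K in \<open>auto simp: mult.commute\<close>)
  from onorm[OF this, of y] on show "norm (f y) \<le> norm y" by simp
  show "Vector_Spaces.linear scl (*) f" by (rule lin)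
  show "f x = of_real (norm x)" using assms by (simp add: norming_functionals_def)
qed

text \<open>The value 1 at the unit vector \<open>x\<close> forces the operator norm of a
  contraction up to 1.\<close>

lemma norming_functionalsI:
  assumes lin: "Vector_Spaces.linear scl (*) f" and le: "\<And>y. norm (f y) \<le> norm y"
    and x: "norm x = 1" "f x = 1"
  shows "f \<in> norming_functionals scl x"
proof -
  interpret f: Vector_Spaces.linear scl "(*)" f by (rule lin)
  have "bounded_linear f"
  proof (rule bounded_linear_intro)
    show "f (r *\<^sub>R y) = r *\<^sub>R f y" for r y
      by (simp flip: scale_of_real add: f.scale scaleR_conv_of_real)
    show "norm (f y) \<le> norm y * 1" for y using le by simp
  qed (rule f.add)
  from onorm[OF this, of x] x have "1 \<le> onorm f" by simp
  moreover have "onorm f \<le> 1" by (rule onorm_bound) (use le in auto)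
  moreover have "\<exists>K. \<forall>y. norm (f y) \<le> K * norm y" using le by (intro exI[of _ 1]) simp
  ultimately show ?thesis
    using lin x by (simp add: norming_functionals_def dual_sphere_def bounded_linear_maps_def)
qed

text \<open>The pair \<open>x\<close>, \<open>f\<close> makes the set under \<open>Sup\<close>
  non-empty, as \<open>cSup_least\<close> demands.\<close>

lemma numerical_radius_le:
  assumes "norm x = 1" and "f \<in> norming_functionals scl x"
    and "\<And>y h. norm y = 1 \<Longrightarrow> h \<in> norming_functionals scl y \<Longrightarrow> norm (h (T y)) \<le> K"
  shows "numerical_radius scl T \<le> K"
  unfolding numerical_radius_def by (rule cSup_least) (use assms in blast)+

lemma numerical_radius_eq:
  assumes "norm x = 1" and "f \<in> norming_functionals scl x" and "norm (f (T x)) = K"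
    and "\<And>y h. norm y = 1 \<Longrightarrow> h \<in> norming_functionals scl y \<Longrightarrow> norm (h (T y)) \<le> K"
  shows "numerical_radius scl T = K"
  unfolding numerical_radius_def by (rule cSup_eq_maximum) (use assms in blast)+

lemma exists_independent_pair:
  assumes "dimension_ge_2 scl"
  shows "\<exists>e u. \<forall>a b. scl a e + scl b u = 0 \<longrightarrow> a = 0 \<and> b = 0"
proof -
  obtain B where B: "independent B" "infinite B \<or> 2 \<le> card B"
    using assms by (auto simp: dimension_ge_2_def)
  obtain F where F: "F \<subseteq> B" "card F = 2"
    using B(2) by (meson infinite_arbitrarily_large obtain_subset_with_card_n)
  then obtain e u where eu: "F = {e, u}" "e \<noteq> u" by (meson card_2_iff)
  have indep: "independent {e, u}" using independent_mono[OF B(1)] F eu by blast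
  have "a = 0 \<and> b = 0" if "scl a e + scl b u = 0" for a b
  proof -
    have "(\<Sum>v\<in>{e, u}. scl (if v = e then a else b) v) = 0" using eu that by simp
    then have "(if v = e then a else b) = 0" if "v \<in> {e, u}" for v
      using independentD[OF indep, of "{e, u}" "\<lambda>v. if v = e then a else b" v] that by simp
    from this[of e] this[of u] show ?thesis using eu by auto
  qed
  then show ?thesis by blast
qed

text \<open>The pair \<open>x\<close>, \<open>f\<close> attains all three suprema because
  \<open>f x = 1\<close>, and contractivity gives the matching upper bounds. Since 2 = 1 + 1, the
  projection is parallel to the identity with phase 1.\<close>

lemma numerical_radius_rank_one:
  assumes x: "norm x = 1" and f: "f \<in> norming_functionals scl x"
  shows "numerical_radius scl (\<lambda>y. scl (f y) x) = 1"
    and "numerical_radius scl (\<lambda>y. scl (f y) x + y) = 2"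
    and "numerical_radius scl (\<lambda>y. y) = 1"
proof -
  interpret f: Vector_Spaces.linear scl "(*)" f by (rule norming_functionalsD(1)[OF f])
  note fD = norming_functionalsD(2)[OF f]
  have fx: "f x = 1" using norming_functionalsD(3)[OF f] x by simp
  have P: "norm (h (scl (f y) x)) \<le> 1" and I: "norm (h y) \<le> 1"
    if "norm y = 1" "h \<in> norming_functionals scl y" for y h
    using that norming_functionalsD(2)[OF that(2), of "scl (f y) x"]
      norming_functionalsD(2)[OF that(2), of y] fD[of y] x by (auto simp: norm_scale)
  show "numerical_radius scl (\<lambda>y. scl (f y) x) = 1"
    by (rule numerical_radius_eq[OF x f]) (use P in \<open>simp_all add: f.scale fx\<close>)
  show "numerical_radius scl (\<lambda>y. y) = 1"
    by (rule numerical_radius_eq[OF x f]) (use I in \<open>simp_all add: fx\<close>)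
  show "numerical_radius scl (\<lambda>y. scl (f y) x + y) = 2"
  proof (rule numerical_radius_eq[OF x f])
    show "norm (f (scl (f x) x + x)) = 2" by (simp add: f.add f.scale fx)
    fix y h assume y: "norm y = 1" and h: "h \<in> norming_functionals scl y"
    interpret h: Vector_Spaces.linear scl "(*)" h by (rule norming_functionalsD(1)[OF h])
    have "norm (h (scl (f y) x + y)) \<le> norm (h (scl (f y) x)) + norm (h y)"
      by (simp add: h.add norm_triangle_ineq)
    with P[OF y h] I[OF y h] show "norm (h (scl (f y) x + y)) \<le> 2" by simp
  qed
qed

lemma rank_one_bounded_operator:
  assumes x: "norm x = 1" and f: "f \<in> norming_functionals scl x"
  shows "(\<lambda>y. scl (f y) x) \<in> bounded_operators scl - {\<lambda>_. 0}"
proof -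
  interpret f: Vector_Spaces.linear scl "(*)" f by (rule norming_functionalsD(1)[OF f])
  have "Vector_Spaces.linear scl scl (\<lambda>y. scl (f y) x)"
    by unfold_locales (simp_all add: f.add f.scale scale_left_distrib)
  moreover have "\<exists>K. \<forall>y. norm (scl (f y) x) \<le> K * norm y"
    using norming_functionalsD(2)[OF f] x by (intro exI[of _ 1]) (simp add: norm_scale)
  moreover have "(\<lambda>y. scl (f y) x) \<noteq> (\<lambda>_. 0)"
  proof
    assume "(\<lambda>y. scl (f y) x) = (\<lambda>_. 0)"
    then have "scl (f x) x = 0" by metis
    then show False using norming_functionalsD(3)[OF f] x by auto
  qed
  ultimately show ?thesis by (simp add: bounded_linear_maps_def)
qed

text \<open>The phase \<open>d\<close> is chosen to align the two summands of \<open>h x + d h z\<close>.\<close>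

lemma numerical_radius_rank_one_sum_le:
  assumes x: "norm x = 1" "f \<in> norming_functionals scl x"
    and z: "norm z = 1" "g \<in> norming_functionals scl z"
    and K: "\<And>d. norm d = 1 \<Longrightarrow> norm (x + scl d z) \<le> K"
    and c: "norm c = 1"
  shows "numerical_radius scl (\<lambda>y. scl (f y) x + scl c (scl (g y) z)) \<le> K"
proof (rule numerical_radius_le[OF x])
  fix y h assume y: "norm y = 1" and h: "h \<in> norming_functionals scl y"
  interpret h: Vector_Spaces.linear scl "(*)" h by (rule norming_functionalsD(1)[OF h])
  obtain d where d: "norm d = 1" "norm (h x + d * h z) = norm (h x) + norm (h z)"
  proof (cases "h x = 0 \<or> h z = 0")
    case True
    then show ?thesis using that[of 1] by auto
  next
    case False
    \<comment> \<open>With this phase \<open>?d * h z\<close> is a positive multiple of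
      \<open>h x\<close> of modulus \<open>norm (h z)\<close>.\<close>
    let ?d = "h x / h z * of_real (norm (h z) / norm (h x))"
    have "h x + ?d * h z = h x * of_real (1 + norm (h z) / norm (h x))"
      using False by (simp add: field_simps)
    then have "norm (h x + ?d * h z) = norm (h x) * \<bar>1 + norm (h z) / norm (h x)\<bar>"
      by (simp only: norm_mult norm_of_real)
    also have "\<dots> = norm (h x) + norm (h z)" using False by (simp add: field_simps)
    finally show ?thesis using False by (intro that[of ?d]) (simp_all add: norm_mult norm_divide)
  qed
  have "norm (h (scl (f y) x + scl c (scl (g y) z))) = norm (f y * h x + c * (g y * h z))"
    by (simp add: h.add h.scale mult.assoc)
  also have "\<dots> \<le> norm (f y) * norm (h x) + norm (g y) * norm (h z)"
    by (rule order_trans[OF norm_triangle_ineq]) (simp add: norm_mult c)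
  also have "\<dots> \<le> norm (h x) + norm (h z)"
    using norming_functionalsD(2)[OF x(2), of y] norming_functionalsD(2)[OF z(2), of y] y
    by (intro add_mono mult_left_le_one_le) auto
  \<comment> \<open>Alignment turns the sum of two moduli into a single value of the contraction
    \<open>h\<close>.\<close>
  also have "\<dots> = norm (h (x + scl d z))" using d by (simp add: h.add h.scale)
  also have "\<dots> \<le> K" using norming_functionalsD(2)[OF h] K[OF d(1)] order_trans by blast
  finally show "norm (h (scl (f y) x + scl c (scl (g y) z))) \<le> K" .
qed

end

section \<open>Two unit vectors whose rotated sums stay away from norm 2\<close>

text \<open>The triangle inequality is applied to
  \<open>x + d z = (x + t d z) + (1 - t) d z\<close>. Quadratic growth at \<open>x\<close> bounds
  the first summand by \<open>sqrt (1 + t)\<close> for a suitable \<open>t\<close>, so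
  \<open>K = 1 - t + sqrt (1 + t)\<close> serves for all \<open>d\<close>.\<close>

lemma exists_nonparallel_unit_vectors:
  fixes scl :: "'f::{real_normed_field,euclidean_space} \<Rightarrow> 'a::real_normed_vector \<Rightarrow> 'a"
  assumes "normed_space_over scl" and dim: "dimension_ge_2 scl"
  shows "\<exists>x z K. norm x = 1 \<and> norm z = 1 \<and> K < 2 \<and> (\<forall>d. norm d = 1 \<longrightarrow> norm (x + scl d z) \<le> K)"
proof -
  interpret normed_space_over scl by fact
  obtain e u where eu: "\<And>a b. scl a e + scl b u = 0 \<Longrightarrow> a = 0 \<and> b = 0"
    using exists_independent_pair[OF dim] by blast
  \<comment> \<open>This identifies pairs of scalars, whose product norm is Euclidean, with the span
    of \<open>e\<close> and \<open>u\<close>.\<close>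
  define L where "L p = scl (fst p) e + scl (snd p) u" for p
  have L_add: "L (p + q) = L p + L q" for p q
    by (simp add: L_def scale_left_distrib algebra_simps)
  have L_scale: "L (s * fst p, s * snd p) = scl s (L p)" for s p
    by (simp add: L_def scale_right_distrib)
  have L_scaleR: "L (r *\<^sub>R p) = r *\<^sub>R L p" for r p
    using L_scale[of "of_real r" p]
    by (cases p) (simp add: scale_of_real scaleR_conv_of_real)
  have L_bound: "norm (L p) \<le> norm p * (norm e + norm u)" for p
  proof -
    have "norm (L p) \<le> norm (fst p) * norm e + norm (snd p) * norm u"
      unfolding L_def by (rule order_trans[OF norm_triangle_ineq]) (simp add: norm_scale)
    also have "\<dots> \<le> norm p * norm e + norm p * norm u"
      using norm_fst_le[of "fst p" "snd p"] norm_snd_le[of "snd p" "fst p"]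
      by (intro add_mono mult_right_mono) auto
    finally show ?thesis by (simp add: algebra_simps)
  qed
  have bl: "bounded_linear L"
    by (rule bounded_linear_intro[OF L_add L_scaleR L_bound])
  have L_pos: "0 < norm (L p)" if "p \<noteq> 0" for p
    using eu[of "fst p" "snd p"] that by (auto simp: L_def prod_eq_iff)
  \<comment> \<open>The sort \<open>euclidean_space\<close> of the scalars makes this sphere
    compact.\<close>
  have "\<exists>p\<in>sphere 0 1. \<forall>q\<in>sphere (0 :: 'f \<times> 'f) 1. norm (L q) \<le> norm (L p)"
  proof (rule continuous_attains_sup)
    have "(1 :: 'f, 0 :: 'f) \<in> sphere 0 1" by (simp add: norm_Pair)
    then show "sphere (0 :: 'f \<times> 'f) 1 \<noteq> {}" by blast
    show "continuous_on (sphere 0 1) (\<lambda>p. norm (L p))"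
      by (intro continuous_on_norm linear_continuous_on bl)
  qed simp
  then obtain p where p: "norm p = 1" and max: "\<And>q. norm q = 1 \<Longrightarrow> norm (L q) \<le> norm (L p)"
    by auto
  obtain a b where ab: "p = (a, b)" by (cases p)
  define M where "M = norm (L p)"
  have M: "0 < M" unfolding M_def using p by (intro L_pos) auto
  \<comment> \<open>By homogeneity, maximality on the sphere bounds \<open>L\<close> everywhere:
    \<open>M\<close> is its operator norm.\<close>
  have le: "norm (L q) \<le> M * norm q" for q
  proof (cases "q = 0")
    case True
    then show ?thesis using L_bound[of 0] by simp
  next
    case False
    then have "norm (L (inverse (norm q) *\<^sub>R q)) \<le> M" unfolding M_def by (intro max) simp
    then show ?thesis using False by (simp add: L_scaleR field_simps)
  qed
  define cnj' where "cnj' c = of_real ((norm c)\<^sup>2) / c" for c :: 'f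
  have norm_cnj': "norm (cnj' c) = norm c" for c
    by (simp add: cnj'_def norm_divide norm_mult power2_eq_square)
  \<comment> \<open>A unit vector orthogonal to \<open>p\<close>: by \<open>rotation_norm\<close>,
    \<open>p + s q\<close> has Euclidean norm \<open>sqrt (1 + (norm s)\<^sup>2)\<close>.\<close>
  define q where "q = (- cnj' b, cnj' a)"
  have q: "norm q = 1" using p by (simp add: q_def ab norm_Pair norm_cnj' add.commute)
  define N where "N = norm (L q)"
  have N: "0 < N" "N \<le> M" unfolding N_def using L_pos[of q] q le[of q] by fastforce+
  have pq: "norm (L p + scl s (L q)) \<le> M * sqrt (1 + (norm s)\<^sup>2)" for s
  proof -
    have "p + (s * fst q, s * snd q) = (a - s * cnj' b, b + s * cnj' a)"
      by (simp add: ab q_def)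
    then have "norm (p + (s * fst q, s * snd q)) =
        sqrt ((1 + (norm s)\<^sup>2) * ((norm a)\<^sup>2 + (norm b)\<^sup>2))"
      using rotation_norm[of a s b] by (simp add: norm_Pair cnj'_def)
    also have "(norm a)\<^sup>2 + (norm b)\<^sup>2 = 1" using p by (simp add: ab norm_Pair)
    finally show ?thesis
      using le[of "p + (s * fst q, s * snd q)"] by (simp add: L_add L_scale)
  qed
  define x where "x = inverse M *\<^sub>R L p"
  define z where "z = inverse N *\<^sub>R L q"
  define k where "k = M / N"
  have k: "1 \<le> k" using N M by (simp add: k_def)
  \<comment> \<open>Chosen so that \<open>(k * t)\<^sup>2 = t\<close>; since
    \<open>1 \<le> k\<close>, the weight \<open>1 - t\<close> is nonnegative.\<close>
  define t where "t = 1 / k\<^sup>2"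
  have t: "0 < t" "t \<le> 1" using k by (auto simp: t_def field_simps)
  have kt: "k\<^sup>2 * t = 1" using k by (simp add: t_def)
  have "norm (x + scl d z) \<le> 1 - t + sqrt (1 + t)" if d: "norm d = 1" for d
  proof -
    \<comment> \<open>As \<open>L p\<close> is \<open>M x\<close> and \<open>L q\<close> is
      \<open>N z\<close>, the factor \<open>M * t / N\<close> gives \<open>d z\<close> the
      coefficient \<open>M * t\<close>.\<close>
    have "L p + scl (of_real (M * t / N) * d) (L q) = M *\<^sub>R (x + t *\<^sub>R scl d z)"
    proof -
      have "scl (of_real r * d) y = r *\<^sub>R scl d y" for r y
        by (simp flip: scale_scale add: scale_of_real)
      moreover have "scl d (r *\<^sub>R y) = r *\<^sub>R scl d y" for r y
        by (metis scale_of_real scale_left_commute)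
      ultimately show ?thesis using M
        by (simp add: x_def z_def scaleR_add_right divide_inverse
            del: of_real_mult of_real_divide of_real_inverse)
    qed
    moreover have "norm (of_real (M * t / N) * d) = k * t"
      using d M N t by (simp add: norm_mult norm_divide k_def)
    ultimately have "norm (M *\<^sub>R (x + t *\<^sub>R scl d z)) \<le> M * sqrt (1 + (k * t)\<^sup>2)"
      using pq[of "of_real (M * t / N) * d"] by simp
    also have "(k * t)\<^sup>2 = t" using kt by (simp add: power2_eq_square algebra_simps)
    finally have "norm (x + t *\<^sub>R scl d z) \<le> sqrt (1 + t)" using M by simp
    moreover have "norm ((1 - t) *\<^sub>R scl d z) = 1 - t"
      using t d N by (simp add: norm_scale z_def N_def)
    moreover have "x + scl d z = (x + t *\<^sub>R scl d z) + (1 - t) *\<^sub>R scl d z"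
      by (simp add: algebra_simps)
    then have "norm (x + scl d z) \<le>
        norm (x + t *\<^sub>R scl d z) + norm ((1 - t) *\<^sub>R scl d z)"
      by (simp only: norm_triangle_ineq)
    ultimately show ?thesis by linarith
  qed
  moreover have "1 - t + sqrt (1 + t) < 2"
  proof -
    have "sqrt (1 + t) < 1 + t" using t by (intro real_less_lsqrt) (auto simp: power2_eq_square)
    then show ?thesis by simp
  qed
  moreover have "norm x = 1" "norm z = 1" using M N by (auto simp: x_def z_def M_def N_def)
  ultimately show ?thesis by blast
qed

section \<open>Failure of transitivity, given norming functionals\<close>

lemma numerical_radius_parallel_not_transitive:
  fixes scl :: "'f::{real_normed_field,euclidean_space} \<Rightarrow> 'a::real_normed_vector \<Rightarrow> 'a"
  assumes "normed_space_over scl" and dim: "dimension_ge_2 scl"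
    and norming: "\<And>x. norm x = 1 \<Longrightarrow> norming_functionals scl x \<noteq> {}"
  shows "\<exists>T \<in> bounded_operators scl - {\<lambda>_. 0}. \<exists>S \<in> bounded_operators scl - {\<lambda>_. 0}.
    \<exists>R \<in> bounded_operators scl - {\<lambda>_. 0}.
      numerical_radius_parallel scl T S \<and> numerical_radius_parallel scl S R \<and>
      \<not> numerical_radius_parallel scl T R"
proof -
  interpret normed_space_over scl by fact
  obtain x z K where x: "norm x = 1" and z: "norm z = 1" and K: "K < 2"
      "\<And>d. norm d = 1 \<Longrightarrow> norm (x + scl d z) \<le> K"
    using exists_nonparallel_unit_vectors[OF assms(1) dim] by blast
  obtain f g where f: "f \<in> norming_functionals scl x" and g: "g \<in> norming_functionals scl z"
    using norming x z by blast
  let ?T = "\<lambda>y. scl (f y) x" and ?I = "\<lambda>y :: 'a. y" and ?R = "\<lambda>y. scl (g y) z"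
  have "Vector_Spaces.linear scl scl ?I" by unfold_locales simp_all
  then have "?I \<in> bounded_operators scl"
    by (auto simp: bounded_linear_maps_def intro!: exI[of _ 1])
  moreover have "?I \<noteq> (\<lambda>_. 0)" using x by (metis norm_zero zero_neq_one)
  moreover have "numerical_radius_parallel scl ?T ?I"
    using numerical_radius_rank_one[OF x f]
    by (auto simp: numerical_radius_parallel_def intro!: exI[of _ 1])
  moreover have "numerical_radius_parallel scl ?I ?R"
    using numerical_radius_rank_one[OF z g]
    by (auto simp: numerical_radius_parallel_def add.commute intro!: exI[of _ 1])
  \<comment> \<open>Both operators have numerical radius 1, so parallelism would require the value
    2, above the bound \<open>K\<close>.\<close>
  moreover have "\<not> numerical_radius_parallel scl ?T ?R"
    using numerical_radius_rank_one_sum_le[OF x f z g K(2)] K(1)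
      numerical_radius_rank_one(1)[OF x f] numerical_radius_rank_one(1)[OF z g]
    by (fastforce simp: numerical_radius_parallel_def)
  ultimately show ?thesis
    using rank_one_bounded_operator[OF x f] rank_one_bounded_operator[OF z g] by blast
qed

section \<open>Norming functionals over both scalar fields, and the conclusion\<close>

lemma norming_functionals_real_nonempty:
  fixes x :: "'a::real_normed_vector"
  assumes x: "norm x = 1"
  shows "norming_functionals (scaleR :: real \<Rightarrow> 'a \<Rightarrow> 'a) x \<noteq> {}"
proof -
  interpret normed_space_over "scaleR :: real \<Rightarrow> 'a \<Rightarrow> 'a" by (rule normed_space_over_scaleR)
  obtain f where f: "linear f" "\<And>y. \<bar>f y\<bar> \<le> norm y" "f x = norm x"
    using exists_norming_linear[of x] by blast
  have "Vector_Spaces.linear scaleR (*) f"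
    by unfold_locales (simp_all add: linear_add[OF f(1)] linear_scale[OF f(1)] algebra_simps)
  then have "f \<in> norming_functionals scaleR x"
    by (rule norming_functionalsI) (use f x in auto)
  then show ?thesis by blast
qed

text \<open>A real norming functional \<open>f\<close> is the real part of the complex-linear
  \<open>F y = f y - \<i> f (\<i> y)\<close>, and passing to \<open>F\<close> does not increase the
  norm.\<close>

lemma norming_functionals_complex_nonempty:
  fixes scl :: "complex \<Rightarrow> 'a::real_normed_vector \<Rightarrow> 'a"
  assumes "normed_space_over scl" and x: "norm x = 1"
  shows "norming_functionals scl x \<noteq> {}"
proof -
  interpret normed_space_over scl by fact
  obtain f where f: "linear f" and f_le: "\<And>y. \<bar>f y\<bar> \<le> norm y" and fx: "f x = norm x"
    using exists_norming_linear[of x] by blast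
  define F where "F y = Complex (f y) (- f (scl \<i> y))" for y
  have scl_Complex: "scl (Complex a b) y = a *\<^sub>R y + b *\<^sub>R scl \<i> y" for a b y
  proof -
    have "Complex a b = of_real a + of_real b * \<i>" by (simp add: complex_eq_iff)
    then show ?thesis by (simp add: scale_left_distrib scale_of_real flip: scale_scale)
  qed
  have scl_ii: "scl \<i> (scl \<i> y) = - y" for y
    using scale_minus_left[of 1 y] by (simp add: scale_scale)
  have scl_i_scaleR: "scl \<i> (r *\<^sub>R y) = r *\<^sub>R scl \<i> y" for r y
    by (metis scale_of_real scale_left_commute)
  have lin: "Vector_Spaces.linear scl (*) F"
  proof unfold_locales
    show "F (y + w) = F y + F w" for y w
      by (simp add: F_def complex_eq_iff linear_add[OF f] scale_right_distrib)
    show "F (scl c y) = c * F y" for c y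
    proof (cases c)
      case (Complex a b)
      have "scl \<i> (scl c y) = a *\<^sub>R scl \<i> y - b *\<^sub>R y"
        by (simp only: Complex scl_Complex scale_right_distrib scl_i_scaleR scl_ii) simp
      then have "f (scl \<i> (scl c y)) = a * f (scl \<i> y) - b * f y"
        by (simp only: linear_diff[OF f] linear_scale[OF f] real_scaleR_def)
      moreover have "f (scl c y) = a * f y + b * f (scl \<i> y)"
        by (simp only: Complex scl_Complex linear_add[OF f] linear_scale[OF f] real_scaleR_def)
      ultimately show ?thesis
        unfolding F_def by (simp only: Complex complex_mult) simp
    qed
  qed
  interpret F: Vector_Spaces.linear scl "(*)" F by (rule lin)
  have le: "cmod (F y) \<le> norm y" for y
  proof (cases "F y = 0")
    case False
    \<comment> \<open>A unimodular factor that makes \<open>F (m y)\<close> the real number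
      \<open>cmod (F y)\<close>, hence equal to \<open>f (m y)\<close>, which the norm
      bounds.\<close>
    define m where "m = of_real (cmod (F y)) / F y"
    have "F (scl m y) = of_real (cmod (F y))" using False by (simp add: m_def F.scale)
    then have "cmod (F y) = f (scl m y)" by (simp add: F_def complex_eq_iff)
    also have "\<dots> \<le> norm (scl m y)" using f_le[of "scl m y"] by simp
    also have "\<dots> = norm y" using False by (simp add: norm_scale m_def norm_divide)
    finally show ?thesis .
  qed simp
  have "F x = 1"
  proof -
    \<comment> \<open>\<open>F x\<close> has real part 1 and modulus at most 1, which leaves no room
      for an imaginary part.\<close>
    have "(cmod (F x))\<^sup>2 \<le> 1" using le[of x] x by (simp add: abs_square_le_1)
    then have "f (scl \<i> x) = 0" using fx x by (simp add: F_def cmod_power2)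
    then show ?thesis using fx x by (simp add: F_def complex_eq_iff)
  qed
  then have "F \<in> norming_functionals scl x" using lin le x by (intro norming_functionalsI)
  then show ?thesis by blast
qed

theorem theorem13:
  fixes scaleC :: "complex \<Rightarrow> 'b::real_normed_vector \<Rightarrow> 'b"
  shows
    "(dimension_ge_2 (scaleR :: real \<Rightarrow> 'a::real_normed_vector \<Rightarrow> 'a) \<longrightarrow>
      (\<exists>T \<in> bounded_operators (scaleR :: real \<Rightarrow> 'a \<Rightarrow> 'a) - {\<lambda>_. 0}.
       \<exists>S \<in> bounded_operators scaleR - {\<lambda>_. 0}.
       \<exists>R \<in> bounded_operators scaleR - {\<lambda>_. 0}.
         numerical_radius_parallel scaleR T S \<and>
         numerical_radius_parallel scaleR S R \<and>
         \<not> numerical_radius_parallel scaleR T R)) \<and>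
     (normed_space_over scaleC \<and> dimension_ge_2 scaleC \<longrightarrow>
      (\<exists>T \<in> bounded_operators scaleC - {\<lambda>_. 0}.
       \<exists>S \<in> bounded_operators scaleC - {\<lambda>_. 0}.
       \<exists>R \<in> bounded_operators scaleC - {\<lambda>_. 0}.
         numerical_radius_parallel scaleC T S \<and>
         numerical_radius_parallel scaleC S R \<and>
         \<not> numerical_radius_parallel scaleC T R))"
proof (intro conjI impI; (elim conjE)?)
  assume "dimension_ge_2 (scaleR :: real \<Rightarrow> 'a \<Rightarrow> 'a)"
  then show "\<exists>T \<in> bounded_operators (scaleR :: real \<Rightarrow> 'a \<Rightarrow> 'a) - {\<lambda>_. 0}.
       \<exists>S \<in> bounded_operators scaleR - {\<lambda>_. 0}. \<exists>R \<in> bounded_operators scaleR - {\<lambda>_. 0}.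
         numerical_radius_parallel scaleR T S \<and> numerical_radius_parallel scaleR S R \<and>
         \<not> numerical_radius_parallel scaleR T R"
    by (intro numerical_radius_parallel_not_transitive normed_space_over_scaleR
        norming_functionals_real_nonempty)
next
  assume "normed_space_over scaleC" "dimension_ge_2 scaleC"
  then show "\<exists>T \<in> bounded_operators scaleC - {\<lambda>_. 0}.
       \<exists>S \<in> bounded_operators scaleC - {\<lambda>_. 0}. \<exists>R \<in> bounded_operators scaleC - {\<lambda>_. 0}.
         numerical_radius_parallel scaleC T S \<and> numerical_radius_parallel scaleC S R \<and>
         \<not> numerical_radius_parallel scaleC T R"
    by (intro numerical_radius_parallel_not_transitive norming_functionals_complex_nonempty)
qed

end
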